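(* Let $n,m\ge 1$ and let $S_n^m = K_n\vee\overline{K_m}$ be the complete split graph. Then the frustration index of the all-negative complete split graph is \[ l(-S_n^m) = \begin{cases} \left\lfloor\frac{(n-1)^2}{4}+\frac{mn}{2}-\frac{m^2}{4}\right\rfloor & \text{if } n > m,\\[2pt] \frac{n(n-1)}{2} & \text{if } n\le m.\end{cases} \]
   Context: All graphs are finite, simple and undirected. A signed graph $\Sigma=(G,\sigma)$ is a graph $G$ with a signature $\sigma:E(G)\to\{+1,-1\}$. The sign of a cycle is the product of the signs of its edges; $\Sigma$ is balanced if all its cycles are positive. The frustration index $l(\Sigma)$ is the minimum number of edges whose deletion makes $\Sigma$ balanced. $-G$ is $G$ with all edges signed $-1$. $\overline{K_m}$ is the edgeless graph on $m$ vertices and $\vee$ denotes the join of vertex-disjoint graphs. *)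

theory Defs
  imports Complex_Main
begin

record 'a graph =
  verts :: "'a set"
  edges :: "'a set set"

text \<open>Edges are two-element vertex sets, so there are no loops and no parallel edges.\<close>

definition simple_graph :: "('a, 'b) graph_scheme \<Rightarrow> bool" where
  "simple_graph G \<longleftrightarrow> finite (verts G) \<and> (\<forall>e \<in> edges G. e \<subseteq> verts G \<and> card e = 2)"

definition complete_graph :: "'a set \<Rightarrow> 'a graph" where
  "complete_graph A = \<lparr>verts = A, edges = {e. e \<subseteq> A \<and> card e = 2}\<rparr>"

definition edgeless_graph :: "'a set \<Rightarrow> 'a graph" where
  "edgeless_graph A = \<lparr>verts = A, edges = {}\<rparr>"

text \<open>Only meaningful when the two vertex sets are disjoint.\<close>

definition join :: "'a graph \<Rightarrow> 'a graph \<Rightarrow> 'a graph" where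
  "join G H = \<lparr>verts = verts G \<union> verts H,
     edges = edges G \<union> edges H \<union> {{u, v} | u v. u \<in> verts G \<and> v \<in> verts H}\<rparr>"

definition complete_split_graph :: "'a set \<Rightarrow> 'a set \<Rightarrow> 'a graph" where
  "complete_split_graph A B = join (complete_graph A) (edgeless_graph B)"

text \<open>Values of the signature outside the edge set are irrelevant.\<close>

record 'a signed_graph = "'a graph" +
  sign :: "'a set \<Rightarrow> int"

definition signed_graph :: "'a signed_graph \<Rightarrow> bool" where
  "signed_graph S \<longleftrightarrow> simple_graph S \<and> (\<forall>e \<in> edges S. sign S e \<in> {1, -1})"

definition all_negative :: "'a graph \<Rightarrow> 'a signed_graph" where
  "all_negative G = \<lparr>verts = verts G, edges = edges G, sign = (\<lambda>_. -1)\<rparr>"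

text \<open>
  A cycle is given by the list of its vertices in cyclic order, without repeating the
  first vertex at the end. For distinct lists of length at least 3 the edges between cyclically
  consecutive vertices are pairwise distinct, so nothing is lost by collecting them in a set.
\<close>

definition cycle_edges :: "'a list \<Rightarrow> 'a set set" where
  "cycle_edges vs = {{vs ! i, vs ! (Suc i mod length vs)} | i. i < length vs}"

definition is_cycle :: "('a, 'b) graph_scheme \<Rightarrow> 'a list \<Rightarrow> bool" where
  "is_cycle G vs \<longleftrightarrow>
     length vs \<ge> 3 \<and> distinct vs \<and> set vs \<subseteq> verts G \<and> cycle_edges vs \<subseteq> edges G"

definition cycle_sign :: "'a signed_graph \<Rightarrow> 'a list \<Rightarrow> int" where
  "cycle_sign S vs = (\<Prod>e \<in> cycle_edges vs. sign S e)"

definition balanced :: "'a signed_graph \<Rightarrow> bool" where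
  "balanced S \<longleftrightarrow> (\<forall>vs. is_cycle S vs \<longrightarrow> cycle_sign S vs = 1)"

definition delete_edges :: "'a signed_graph \<Rightarrow> 'a set set \<Rightarrow> 'a signed_graph" where
  "delete_edges S F = S\<lparr>edges := edges S - F\<rparr>"

definition frustration_index :: "'a signed_graph \<Rightarrow> nat" where
  "frustration_index S = Min {card F | F. F \<subseteq> edges S \<and> balanced (delete_edges S F)}"

text \<open>
  The minimum is taken over a finite nonempty set, because deleting all edges leaves no cycle.
\<close>

lemma simple_graph_finite_edges:
  assumes "simple_graph G"
  shows "finite (edges G)"
proof (rule finite_subset)
  show "edges G \<subseteq> Pow (verts G)"
    using assms by (auto simp: simple_graph_def)
  show "finite (Pow (verts G))"
    using assms by (simp add: simple_graph_def)
qed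

lemma balanced_delete_all_edges: "balanced (delete_edges S (edges S))"
proof -
  have "\<not> is_cycle (delete_edges S (edges S)) vs" for vs
    by (cases vs) (auto simp: is_cycle_def cycle_edges_def delete_edges_def)
  then show ?thesis
    by (simp add: balanced_def)
qed

lemma frustration_index_set_finite_nonempty:
  assumes "signed_graph S"
  shows "finite {card F | F. F \<subseteq> edges S \<and> balanced (delete_edges S F)}"
    and "{card F | F. F \<subseteq> edges S \<and> balanced (delete_edges S F)} \<noteq> {}"
proof -
  have "finite (edges S)"
    using assms by (simp add: signed_graph_def simple_graph_finite_edges)
  then have "finite (card ` Pow (edges S))"
    by simp
  then show "finite {card F | F. F \<subseteq> edges S \<and> balanced (delete_edges S F)}"
    by (rule rev_finite_subset) auto
  show "{card F | F. F \<subseteq> edges S \<and> balanced (delete_edges S F)} \<noteq> {}"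
    using balanced_delete_all_edges by blast
qed

lemma signed_graph_all_negative_complete_split:
  assumes "finite A" "finite B" "A \<inter> B = {}"
  shows "signed_graph (all_negative (complete_split_graph A B))"
proof -
  have "card {u, v} = 2" if "u \<in> A" "v \<in> B" for u v
    using assms(3) that by (subst card_2_iff) blast
  then show ?thesis
    using assms
    by (auto simp: signed_graph_def simple_graph_def all_negative_def complete_split_graph_def
        join_def complete_graph_def edgeless_graph_def)
qed

end

theory Submission imports Defs begin

text \<open>
  Write \<open>q = \<lfloor>(n - m)\<^sup>2 / 4\<rfloor>\<close>, with truncated subtraction, so that \<open>q = 0\<close> for \<open>n \<le> m\<close>.
  What remains after the deletion contains no triangle, and a triangle-free subgraph of the complete
  split graph has at most \<open>m n + q\<close> edges. This follows as in Mantel's theorem: the two ends of an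
  edge inside the clique have no common neighbour, so removing them destroys at most \<open>n + m - 1\<close>
  edges, and one inducts on \<open>n\<close>; if no edge inside the clique is left, there are at most \<open>m n\<close> edges.
  Equality holds for the cut separating the independent set together with \<open>\<lfloor>(n - m) / 2\<rfloor>\<close> clique
  vertices from the rest, since every cycle crosses a cut an even number of times.
\<close>

section \<open>Edges of the complete split graph\<close>

lemma edges_complete_split:
  "edges (complete_split_graph A B) =
     {e. e \<subseteq> A \<and> card e = 2} \<union> {{u, v} | u v. u \<in> A \<and> v \<in> B}"
  by (simp add: complete_split_graph_def join_def complete_graph_def edgeless_graph_def)

lemma edge_complete_split_iff:
  assumes "A \<inter> B = {}"
  shows "{u, v} \<in> edges (complete_split_graph A B) \<longleftrightarrow>
    u \<noteq> v \<and> u \<in> A \<union> B \<and> v \<in> A \<union> B \<and> (u \<in> A \<or> v \<in> A)"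
  using assms by (auto simp: edges_complete_split doubleton_eq_iff card_insert_if)

lemma edge_complete_splitE:
  assumes "e \<in> edges (complete_split_graph A B)" "A \<inter> B = {}"
  obtains u v where "e = {u, v}" "u \<noteq> v" "u \<in> A" "v \<in> A \<union> B"
proof -
  have "\<exists>u v. e = {u, v}"
    using assms(1) unfolding edges_complete_split card_2_iff by blast
  then obtain u v where "e = {u, v}"
    by blast
  then show thesis
    using that[of u v] that[of v u] assms by (auto simp: edge_complete_split_iff insert_commute)
qed

text \<open>Disjointness makes \<open>(u, v)\<close> recoverable from the unordered pair. This
  counts both the edges between \<open>A\<close> and \<open>B\<close> and the edges of a
  cut.\<close>

lemma card_doubletons:
  assumes "finite X" "finite Y" "X \<inter> Y = {}"
  shows "card {{u, v} | u v. u \<in> X \<and> v \<in> Y} = card X * card Y"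
proof -
  have "{{u, v} | u v. u \<in> X \<and> v \<in> Y} = (\<lambda>(u, v). {u, v}) ` (X \<times> Y)"
    by auto
  moreover have "inj_on (\<lambda>(u, v). {u, v}) (X \<times> Y)"
    using assms(3) by (auto simp: inj_on_def doubleton_eq_iff)
  ultimately show ?thesis
    by (simp add: card_image card_cartesian_product)
qed

lemma finite_doubletons:
  assumes "finite X" "finite Y"
  shows "finite {{u, v} | u v. u \<in> X \<and> v \<in> Y}"
  using finite_image_set2[of "\<lambda>u. u \<in> X" "\<lambda>v. v \<in> Y" "\<lambda>u v. {u, v}"] assms by simp

lemma finite_edges_complete_split:
  assumes "finite A" "finite B"
  shows "finite (edges (complete_split_graph A B))"
  using assms by (simp add: edges_complete_split finite_doubletons)

lemma card_edges_complete_split: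
  assumes "finite A" "finite B" "A \<inter> B = {}"
  shows "card (edges (complete_split_graph A B)) = (card A choose 2) + card A * card B"
proof -
  have "{e. e \<subseteq> A \<and> card e = 2} \<inter> {{u, v} | u v. u \<in> A \<and> v \<in> B} = {}"
    using assms(3) by auto
  then show ?thesis
    using assms
    by (simp add: edges_complete_split card_Un_disjoint finite_doubletons n_subsets card_doubletons)
qed

section \<open>Mantel-type bound for triangle-free subgraphs\<close>

definition triangle_free :: "'a set set \<Rightarrow> bool" where
  "triangle_free E \<longleftrightarrow>
     (\<nexists>u v w. distinct [u, v, w] \<and> {u, v} \<in> E \<and> {v, w} \<in> E \<and> {w, u} \<in> E)"

text \<open>Arithmetic of the induction step from \<open>n\<close> to \<open>n + 2\<close> clique
  vertices, where \<open>(n + 2) + m - 1\<close> edges may be lost. For \<open>m \<le> n\<close> it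
  is an equality; for \<open>n < m\<close> the left square vanishes by truncation and
  \<open>n + m + 1 \<le> 2 * m\<close> suffices.\<close>

lemma square_diff_div_4_step:
  fixes n m :: nat
  shows "n * m + (n - m)\<^sup>2 div 4 + (n + m + 1) \<le> (n + 2) * m + (n + 2 - m)\<^sup>2 div 4"
proof (cases "m \<le> n")
  case True
  then obtain k where "n = m + k"
    using le_Suc_ex by blast
  moreover have "(k + 2)\<^sup>2 = k\<^sup>2 + 4 * (k + 1)"
    by (simp add: power2_eq_square algebra_simps)
  then have "(k + 2)\<^sup>2 div 4 = k\<^sup>2 div 4 + (k + 1)"
    by simp
  ultimately show ?thesis
    by (simp add: algebra_simps)
qed (simp add: algebra_simps)

lemma card_triangle_free_le:
  assumes "finite A" "finite B" "A \<inter> B = {}"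
    and "E \<subseteq> edges (complete_split_graph A B)" "triangle_free E"
  shows "card E \<le> card A * card B + (card A - card B)\<^sup>2 div 4"
  using assms
proof (induction "card A" arbitrary: A E rule: less_induct)
  case less
  note fin = \<open>finite A\<close> \<open>finite B\<close>
  have finE: "finite E"
    using finite_edges_complete_split[OF fin] less.prems(4) finite_subset by blast
  show ?case
  proof (cases "\<exists>u\<in>A. \<exists>v\<in>A. u \<noteq> v \<and> {u, v} \<in> E")
    case False
    have "E \<subseteq> {{u, v} | u v. u \<in> A \<and> v \<in> B}"
    proof
      fix e assume "e \<in> E"
      then have "e \<in> edges (complete_split_graph A B)"
        using less.prems(4) by blast
      then obtain x y where "e = {x, y}" "x \<noteq> y" "x \<in> A" "y \<in> A \<union> B"
        using less.prems(3) by (rule edge_complete_splitE)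
      then show "e \<in> {{u, v} | u v. u \<in> A \<and> v \<in> B}"
        using False \<open>e \<in> E\<close> by blast
    qed
    then have "card E \<le> card A * card B"
      unfolding card_doubletons[OF fin less.prems(3), symmetric]
      by (rule card_mono[OF finite_doubletons[OF fin]])
    then show ?thesis
      by linarith
  next
    case True
    then obtain u v where uv: "u \<in> A" "v \<in> A" "u \<noteq> v" "{u, v} \<in> E"
      by blast
    define A' where "A' = A - {u, v}"
    define E' where "E' = {e \<in> E. u \<notin> e \<and> v \<notin> e}"
    \<comment> \<open>Without a common neighbour of \<open>u\<close> and \<open>v\<close>,
      \<open>f w\<close> is the only possible edge from \<open>w\<close> to these two. So
      \<open>f\<close> covers all edges meeting \<open>{u, v}\<close> except \<open>{u, v}\<close>
      itself. Its default value need not lie in \<open>E\<close>, which is harmless for an upper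
      bound.\<close>
    define f where "f w = (if {u, w} \<in> E then {u, w} else {v, w})" for w
    have "card {u, v} \<le> card A"
      using uv fin by (intro card_mono) auto
    then have cardA: "card A = card A' + 2"
      using uv fin by (simp add: A'_def card_Diff_subset)
    have "E' \<subseteq> edges (complete_split_graph A' B)"
    proof
      fix e assume "e \<in> E'"
      then have "e \<in> edges (complete_split_graph A B)" "u \<notin> e" "v \<notin> e"
        using less.prems(4) by (auto simp: E'_def)
      then show "e \<in> edges (complete_split_graph A' B)"
        by (auto simp: edges_complete_split A'_def)
    qed
    moreover have "triangle_free E'"
      using less.prems(5) unfolding triangle_free_def E'_def by blast
    ultimately have IH: "card E' \<le> card A' * card B + (card A' - card B)\<^sup>2 div 4"
      using less.hyps[of A' E'] cardA fin less.prems(3) by (auto simp: A'_def)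
    have "E \<subseteq> E' \<union> {{u, v}} \<union> f ` (A' \<union> B)"
    proof
      fix e assume e: "e \<in> E"
      then have eS: "e \<in> edges (complete_split_graph A B)"
        using less.prems(4) by blast
      have through: "e \<in> {{u, v}} \<union> f ` (A' \<union> B)" if "x \<in> e" "x \<in> {u, v}" for x
      proof -
        obtain w where w: "e = {x, w}" "w \<in> A \<union> B" "w \<noteq> x"
        proof -
          obtain y z where "e = {y, z}" "y \<noteq> z" "y \<in> A" "z \<in> A \<union> B"
            using eS less.prems(3) by (rule edge_complete_splitE)
          then show thesis
            using that(1)[of y] that(1)[of z] \<open>x \<in> e\<close> by (auto simp: insert_commute)
        qed
        show ?thesis
        proof (cases "w \<in> {u, v}")
          case True
          then show ?thesis
            using w that by auto
        next
          case False
          have "\<not> ({u, w} \<in> E \<and> {v, w} \<in> E)"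
            using less.prems(5) uv(3,4) False unfolding triangle_free_def
            by (auto simp: insert_commute)
          then have "f w = e"
            using e w(1) that(2) by (auto simp: f_def)
          then show ?thesis
            using w False by (auto simp: A'_def)
        qed
      qed
      show "e \<in> E' \<union> {{u, v}} \<union> f ` (A' \<union> B)"
        using e through by (auto simp: E'_def)
    qed
    moreover have "finite A'" "finite E'"
      using fin finE by (auto simp: A'_def E'_def)
    ultimately have "card E \<le> card (E' \<union> {{u, v}} \<union> f ` (A' \<union> B))"
      using fin by (intro card_mono) auto
    also have "\<dots> \<le> card E' + 1 + card (f ` (A' \<union> B))"
      using card_Un_le[of "E' \<union> {{u, v}}" "f ` (A' \<union> B)"] card_Un_le[of E' "{{u, v}}"] by simp
    also have "\<dots> \<le> card E' + (card A' + card B + 1)"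
      using card_image_le[of "A' \<union> B" f] card_Un_le[of A' B] \<open>finite A'\<close> fin by simp
    also have "\<dots> \<le> card A * card B + (card A - card B)\<^sup>2 div 4"
      using IH square_diff_div_4_step[of "card A'" "card B"] unfolding cardA by linarith
    finally show ?thesis .
  qed
qed

section \<open>Balance: a necessary and a sufficient condition\<close>

lemma cycle_edges_image:
  "cycle_edges vs = (\<lambda>i. {vs ! i, vs ! (Suc i mod length vs)}) ` {..<length vs}"
  unfolding cycle_edges_def by blast

lemma cycle_edges_triangle: "cycle_edges [u, v, w] = {{u, v}, {v, w}, {w, u}}"
proof -
  have "cycle_edges [u, v, w] = {{w, u}, {v, w}, {u, v}}"
    unfolding cycle_edges_image by (simp add: lessThan_Suc)
  then show ?thesis
    by (simp add: insert_commute)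
qed

lemma triangle_free_if_balanced:
  assumes "simple_graph G" "balanced (delete_edges (all_negative G) F)"
  shows "triangle_free (edges G - F)"
  unfolding triangle_free_def
proof (intro notI, elim exE conjE)
  fix u v w
  assume d: "distinct [u, v, w]"
    and e: "{u, v} \<in> edges G - F" "{v, w} \<in> edges G - F" "{w, u} \<in> edges G - F"
  let ?S = "delete_edges (all_negative G) F"
  have "{u, v, w} \<subseteq> verts G"
    using assms(1) e unfolding simple_graph_def by blast
  then have "is_cycle ?S [u, v, w]"
    using d e by (simp add: is_cycle_def cycle_edges_triangle delete_edges_def all_negative_def)
  \<comment> \<open>The sign is a product over a set, so the three edges must be shown distinct to
    get three factors -1.\<close>
  moreover have "cycle_sign ?S [u, v, w] = -1"
    using d by (auto simp: cycle_sign_def cycle_edges_triangle delete_edges_def all_negative_def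
        card_insert_if doubleton_eq_iff)
  ultimately show False
    using assms(2) unfolding balanced_def by force
qed

lemma Suc_mod_inj:
  assumes "i < k" "j < k" "Suc i mod k = Suc j mod k"
  shows "i = j"
  using assms by (auto simp: mod_Suc split: if_splits)

text \<open>Allows the product over the edge set to be taken over positions. Two distinct positions
  with the same edge would be cyclic successors of each other, which forces length 2.\<close>

lemma inj_on_cycle_edge:
  assumes "distinct vs" "length vs \<ge> 3"
  shows "inj_on (\<lambda>i. {vs ! i, vs ! (Suc i mod length vs)}) {..<length vs}"
proof (rule inj_onI)
  fix i j
  let ?k = "length vs"
  assume ij: "i \<in> {..<?k}" "j \<in> {..<?k}"
    and eq: "{vs ! i, vs ! (Suc i mod ?k)} = {vs ! j, vs ! (Suc j mod ?k)}"
  have lt: "Suc i mod ?k < ?k" "Suc j mod ?k < ?k"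
    using assms(2) by (auto intro!: mod_less_divisor)
  have "i = j \<or> (i = Suc j mod ?k \<and> j = Suc i mod ?k)"
    using eq ij lt assms(1) by (auto simp: doubleton_eq_iff nth_eq_iff_index_eq)
  then show "i = j"
    using ij assms(2) by (auto simp: mod_Suc split: if_splits)
qed

text \<open>
  Harary's criterion: multiplying the signs \<open>c u * c v\<close> around a cycle counts every vertex twice.
\<close>

lemma balanced_if_switching:
  assumes c: "\<And>v. c v \<in> {1, -1 :: int}"
    and sgn: "\<And>u v. {u, v} \<in> edges S \<Longrightarrow> sign S {u, v} = c u * c v"
  shows "balanced S"
  unfolding balanced_def
proof (intro allI impI)
  fix vs assume "is_cycle S vs"
  then have vs: "length vs \<ge> 3" "distinct vs" and sub: "cycle_edges vs \<subseteq> edges S"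
    by (auto simp: is_cycle_def)
  let ?k = "length vs"
  let ?s = "\<lambda>i. Suc i mod ?k"
  note img = cycle_edges_image[of vs]
  \<comment> \<open>The cyclic shift is an injective self-map of a finite set, hence a permutation
    of the positions.\<close>
  have "inj_on ?s {..<?k}"
    by (auto intro!: inj_onI dest: Suc_mod_inj)
  moreover have "?s ` {..<?k} \<subseteq> {..<?k}"
    using vs(1) by (auto intro!: mod_less_divisor)
  ultimately have bij: "bij_betw ?s {..<?k} {..<?k}"
    by (simp add: bij_betw_def endo_inj_surj)
  have "cycle_sign S vs = (\<Prod>i<?k. sign S {vs ! i, vs ! ?s i})"
    unfolding cycle_sign_def img by (simp add: prod.reindex inj_on_cycle_edge vs)
  also have "\<dots> = (\<Prod>i<?k. c (vs ! i) * c (vs ! ?s i))"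
    using sub img by (intro prod.cong refl sgn) auto
  also have "\<dots> = (\<Prod>i<?k. c (vs ! i)) * (\<Prod>i<?k. c (vs ! ?s i))"
    by (simp add: prod.distrib)
  also have "(\<Prod>i<?k. c (vs ! ?s i)) = (\<Prod>i<?k. c (vs ! i))"
    by (rule prod.reindex_bij_betw[OF bij])
  also have "(\<Prod>i<?k. c (vs ! i)) * (\<Prod>i<?k. c (vs ! i)) = (\<Prod>i<?k. c (vs ! i) * c (vs ! i))"
    by (simp add: prod.distrib)
  also have "\<dots> = 1"
  proof (intro prod.neutral ballI)
    show "c (vs ! i) * c (vs ! i) = 1" for i
      using c[of "vs ! i"] by auto
  qed
  finally show "cycle_sign S vs = 1" .
qed

text \<open>Switch by the side of the cut: each remaining edge has exactly one end in
  \<open>X\<close>, so the values at its ends multiply to -1, its sign.\<close>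

lemma balanced_all_negative_cut:
  assumes "edges G - F \<subseteq> {{u, v} | u v. u \<in> X \<and> v \<in> Y}" "X \<inter> Y = {}"
  shows "balanced (delete_edges (all_negative G) F)"
proof (rule balanced_if_switching[where c = "\<lambda>v. if v \<in> X then 1 else -1"])
  fix u v
  assume "{u, v} \<in> edges (delete_edges (all_negative G) F)"
  then have "{u, v} \<in> edges G - F"
    by (simp add: delete_edges_def all_negative_def)
  then have "(u \<in> X \<and> v \<in> Y) \<or> (v \<in> X \<and> u \<in> Y)"
    using assms(1) by (auto simp: doubleton_eq_iff)
  then show "sign (delete_edges (all_negative G) F) {u, v} =
      (if u \<in> X then 1 else -1) * (if v \<in> X then 1 else -1)"
    using assms(2) by (auto simp: delete_edges_def all_negative_def)
qed simp

section \<open>A largest cut\<close>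

lemma half_times_half:
  fixes k :: nat
  shows "(k div 2) * (k - k div 2) = k\<^sup>2 div 4"
proof (cases "even k")
  case True
  then obtain j where "k = 2 * j"
    by blast
  then show ?thesis
    by (simp add: power2_eq_square)
next
  case False
  then obtain j where k: "k = 2 * j + 1"
    by (rule oddE)
  then have "k\<^sup>2 = 4 * (j * (j + 1)) + 1"
    by (simp add: power2_eq_square algebra_simps)
  then show ?thesis
    using k by simp
qed

lemma max_cut_complete_split:
  assumes "finite A" "finite B" "A \<inter> B = {}"
  obtains X Y where "X \<inter> Y = {}"
    "{{u, v} | u v. u \<in> X \<and> v \<in> Y} \<subseteq> edges (complete_split_graph A B)"
    "card {{u, v} | u v. u \<in> X \<and> v \<in> Y} = card A * card B + (card A - card B)\<^sup>2 div 4"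
proof -
  let ?n = "card A" and ?m = "card B"
  \<comment> \<open>Moving \<open>b\<close> clique vertices to the side of \<open>B\<close> gives a
    cut of size \<open>(n - b) * (m + b) = n * m + b * (n - m - b)\<close>, which is largest when
    \<open>b\<close> is about half of \<open>n - m\<close>. For \<open>n \<le> m\<close> none is
    moved.\<close>
  define b where "b = (?n - ?m) div 2"
  obtain D where D: "D \<subseteq> A" "card D = b"
    by (metis b_def diff_le_self div_le_dividend le_trans obtain_subset_with_card_n)
  let ?X = "A - D" and ?Y = "D \<union> B"
  have fin: "finite D" "finite ?X" "finite ?Y"
    using D assms finite_subset by auto
  have disj: "?X \<inter> ?Y = {}" "D \<inter> B = {}"
    using D assms(3) by auto
  have "card {{u, v} | u v. u \<in> ?X \<and> v \<in> ?Y} = (?n - b) * (b + ?m)"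
    using card_doubletons[OF fin(2,3) disj(1)] D fin assms disj(2)
    by (simp add: card_Diff_subset card_Un_disjoint)
  also have "\<dots> = ?n * ?m + b * (?n - ?m - b)"
  \<comment> \<open>Substituting \<open>n = m + b + l\<close> eliminates the truncated subtractions;
    if \<open>n < m\<close>, then \<open>b = 0\<close> and both sides are
    \<open>n * m\<close>.\<close>
  proof (cases "?m \<le> ?n")
    case True
    then obtain k where "?n = ?m + k"
      using le_Suc_ex by blast
    moreover obtain l where "k = b + l"
      using \<open>?n = ?m + k\<close> le_Suc_ex[of b k] by (auto simp: b_def)
    ultimately show ?thesis
      by (simp add: algebra_simps)
  qed (simp add: b_def)
  also have "b * (?n - ?m - b) = (?n - ?m)\<^sup>2 div 4"
    unfolding b_def by (rule half_times_half)
  finally have card: "card {{u, v} | u v. u \<in> ?X \<and> v \<in> ?Y} = ?n * ?m + (?n - ?m)\<^sup>2 div 4" .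
  have sub: "{{u, v} | u v. u \<in> ?X \<and> v \<in> ?Y} \<subseteq> edges (complete_split_graph A B)"
  proof
    fix e assume "e \<in> {{u, v} | u v. u \<in> ?X \<and> v \<in> ?Y}"
    then obtain u v where "e = {u, v}" "u \<in> ?X" "v \<in> ?Y"
      by blast
    then show "e \<in> edges (complete_split_graph A B)"
      using D edge_complete_split_iff[OF assms(3)] assms(3) by auto
  qed
  show ?thesis
    using that[OF disj(1) sub card] .
qed

section \<open>The frustration index and its closed form\<close>

theorem frustration_index_complete_split:
  assumes "finite A" "finite B" "A \<inter> B = {}"
  shows "frustration_index (all_negative (complete_split_graph A B)) +
    (card A - card B)\<^sup>2 div 4 = card A choose 2"
proof -
  let ?G = "complete_split_graph A B"
  let ?S = "all_negative ?G"
  let ?q = "(card A - card B)\<^sup>2 div 4"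
  have signed: "signed_graph ?S"
    using assms by (rule signed_graph_all_negative_complete_split)
  then have simple: "simple_graph ?G"
    by (simp add: signed_graph_def simple_graph_def all_negative_def)
  have finE: "finite (edges ?G)"
    using assms finite_edges_complete_split by blast
  note cardE = card_edges_complete_split[OF assms]
  have edges_S: "edges ?S = edges ?G"
    by (simp add: all_negative_def)
  obtain X Y where XY: "X \<inter> Y = {}"
    and max_cut: "{{u, v} | u v. u \<in> X \<and> v \<in> Y} \<subseteq> edges ?G"
      "card {{u, v} | u v. u \<in> X \<and> v \<in> Y} = card A * card B + ?q"
    using max_cut_complete_split[OF assms] .
  define C where "C = {{u, v} | u v. u \<in> X \<and> v \<in> Y}"
  have cut: "C \<subseteq> edges ?G" and cardC: "card C = card A * card B + ?q"
    using max_cut by (simp_all add: C_def)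
  \<comment> \<open>The cut has at most as many edges as the graph; cancelling \<open>m * n\<close>
    gives the bound. It makes the subtraction below exact.\<close>
  have q: "?q \<le> card A choose 2"
    using card_mono[OF finE cut] cardE cardC by linarith
  have "frustration_index ?S = (card A choose 2) - ?q"
    unfolding frustration_index_def
  proof (rule Min_eqI)
    show "finite {card F | F. F \<subseteq> edges ?S \<and> balanced (delete_edges ?S F)}"
      using signed by (rule frustration_index_set_finite_nonempty)
  next
    fix k assume "k \<in> {card F | F. F \<subseteq> edges ?S \<and> balanced (delete_edges ?S F)}"
    then obtain F where F: "k = card F" "F \<subseteq> edges ?G" "balanced (delete_edges ?S F)"
      using edges_S by auto
    have "card (edges ?G - F) \<le> card A * card B + ?q"
      using triangle_free_if_balanced[OF simple F(3)] assms by (intro card_triangle_free_le) auto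
    moreover have "card (edges ?G - F) = card (edges ?G) - card F"
      using F finE finite_subset by (intro card_Diff_subset) auto
    ultimately show "(card A choose 2) - ?q \<le> k"
      using F(1) cardE by linarith
  next
    \<comment> \<open>The minimum is attained by deleting every edge outside the largest
      cut.\<close>
    let ?F = "edges ?G - C"
    have "balanced (delete_edges ?S ?F)"
      using XY by (intro balanced_all_negative_cut) (auto simp: C_def)
    moreover have "card ?F = (card A choose 2) - ?q"
      using cut finE cardC cardE finite_subset[OF cut finE] by (simp add: card_Diff_subset)
    ultimately show "(card A choose 2) - ?q \<in>
        {card F | F. F \<subseteq> edges ?S \<and> balanced (delete_edges ?S F)}"
      using edges_S by (metis (mono_tags, lifting) Diff_subset mem_Collect_eq)
  qed
  then show ?thesis
    using q by simp
qed

text \<open>Squares are 0 or 1 modulo 4, which keeps the rounding error in the floor formula below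
  1.\<close>

lemma square_mod_4_le: "(k :: nat)\<^sup>2 mod 4 \<le> 1"
proof (cases "even k")
  case False
  then obtain j where "k = 2 * j + 1"
    by (rule oddE)
  then have "k\<^sup>2 = 4 * (j * (j + 1)) + 1"
    by (simp add: power2_eq_square algebra_simps)
  then show ?thesis
    by simp
qed (auto simp: power2_eq_square)

theorem lemma27:
  fixes A B :: "'a set" and n m :: nat
  assumes "n \<ge> 1" and "m \<ge> 1"
    and "finite A" and "card A = n"
    and "finite B" and "card B = m"
    and "A \<inter> B = {}"
  shows "real (frustration_index (all_negative (complete_split_graph A B))) =
    (if n > m
     then real_of_int \<lfloor>(real n - 1)\<^sup>2 / 4 + real m * real n / 2 - (real m)\<^sup>2 / 4\<rfloor>
     else real n * (real n - 1) / 2)"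
proof -
  define l where "l = frustration_index (all_negative (complete_split_graph A B))"
  define q where "q = (n - m)\<^sup>2 div 4"
  have "l + q = n choose 2"
    using frustration_index_complete_split[OF assms(3,5,7)] assms(4,6) by (simp add: l_def q_def)
  moreover have "real (n choose 2) = real n * (real n - 1) / 2"
    using assms(1) by (simp add: choose_two real_of_nat_div)
  ultimately have l: "real l + real q = real n * (real n - 1) / 2"
    by (metis of_nat_add)
  show ?thesis
  proof (cases "n > m")
    case False
    \<comment> \<open>Here \<open>n - m\<close> truncates to 0, so \<open>q = 0\<close>.\<close>
    then show ?thesis
      using l by (simp add: q_def flip: l_def)
  next
    case True
    define r where "r = (n - m)\<^sup>2 mod 4"
    have "(n - m)\<^sup>2 = 4 * q + r"
      by (simp add: q_def r_def)
    then have sq: "(real n - real m)\<^sup>2 = 4 * real q + real r"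
      using True
      by (metis of_nat_add of_nat_diff of_nat_mult of_nat_numeral of_nat_power less_imp_le)
    have "r \<le> 1"
      unfolding r_def by (rule square_mod_4_le)
    \<comment> \<open>Rewriting around \<open>(n - m)\<^sup>2 / 4 = q + r / 4\<close> shows the
      expression to be \<open>l + (1 - r) / 4\<close>. As \<open>r\<close> is 0 or 1, the excess is
      1/4 or 0, and the floor is \<open>l\<close>.\<close>
    have "(real n - 1)\<^sup>2 / 4 + real m * real n / 2 - (real m)\<^sup>2 / 4 =
        real n * (real n - 1) / 2 - (real n - real m)\<^sup>2 / 4 + 1 / 4"
      by (simp add: power2_eq_square field_simps)
    also have "\<dots> = real l + (1 - real r) / 4"
      using l sq by (simp add: field_simps)
    finally have "\<lfloor>(real n - 1)\<^sup>2 / 4 + real m * real n / 2 - (real m)\<^sup>2 / 4\<rfloor> = int l"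
      using \<open>r \<le> 1\<close> by (intro floor_unique) (auto simp: field_simps)
    then show ?thesis
      using True by (simp flip: l_def)
  qed
qed

end
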